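(* Let $A_1,A_2,A_3$ be three non-concurrent non-null lines such that the points $A_1A_2$, $A_2A_3$, $A_1A_3$ are all non-null. Let $a$ be a non-null point, distinct from these three points, whose joins with $A_2A_3$, $A_1A_3$ and $A_1A_2$ are non-null lines $D_1$, $D_2$ and $D_3$ respectively. Define the spreads $$R_1\equiv S(A_2,D_1),\quad T_1\equiv S(D_1,A_3),\quad R_2\equiv S(A_3,D_2),\quad T_2\equiv S(D_2,A_1),\quad R_3\equiv S(A_1,D_3),\quad T_3\equiv S(D_3,A_2).$$ Then $$R_1R_2R_3=T_1T_2T_3.$$
   Context: Let $\mathbb F$ be a field of characteristic not two. A 3-proportion $x:y:z$ is a triple of elements of $\mathbb F$, not all zero, up to a common non-zero scalar. A point $a=[x:y:z]$ and a line $L=(l:m:n)$ are both 3-proportions. The point $[x:y:z]$ lies on the line $(l:m:n)$ when $lx+my-nz=0$. For distinct points $a,b$, the join is the unique line through both; for distinct lines $L,M$, the meet $LM$ is the unique point lying on both. A point $[x:y:z]$ is null when $x^2+y^2-z^2=0$; a line $(l:m:n)$ is null when $l^2+m^2-n^2=0$. The spread between non-null lines $L_1=(l_1:m_1:n_1)$, $L_2=(l_2:m_2:n_2)$ is $$S(L_1,L_2)=1-\frac{(l_1l_2+m_1m_2-n_1n_2)^2}{(l_1^2+m_1^2-n_1^2)(l_2^2+m_2^2-n_2^2)};$$ it is undefined if either line is null. *)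

theory Defs
  imports Main
begin

definition proportional :: "'a::field \<times> 'a \<times> 'a \<Rightarrow> 'a \<times> 'a \<times> 'a \<Rightarrow> bool" where
  "proportional = (\<lambda>(x, y, z) (x', y', z').
     (x, y, z) \<noteq> (0, 0, 0) \<and> (x', y', z') \<noteq> (0, 0, 0) \<and>
     (\<exists>c. c \<noteq> 0 \<and> x' = c * x \<and> y' = c * y \<and> z' = c * z))"

lemma part_equivp_proportional: "part_equivp (proportional :: 'a::field \<times> 'a \<times> 'a \<Rightarrow> _)"
proof (rule part_equivpI)
  have "proportional (1, 0, 0) (1, 0, 0 :: 'a)"
    by (auto simp: proportional_def intro: exI[of _ 1])
  then show "\<exists>u :: 'a \<times> 'a \<times> 'a. proportional u u" by blast
  show "symp (proportional :: 'a \<times> 'a \<times> 'a \<Rightarrow> _)"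
  proof (rule sympI)
    fix u v :: "'a \<times> 'a \<times> 'a"
    assume "proportional u v"
    then obtain x y z c where u: "u = (x, y, z)" "u \<noteq> (0, 0, 0)" "v \<noteq> (0, 0, 0)"
      and c: "c \<noteq> 0" "v = (c * x, c * y, c * z)"
      by (cases u; cases v) (auto simp: proportional_def)
    then show "proportional v u"
      by (auto simp: proportional_def intro!: exI[of _ "inverse c"])
  qed
  show "transp (proportional :: 'a \<times> 'a \<times> 'a \<Rightarrow> _)"
  proof (rule transpI)
    fix u v w :: "'a \<times> 'a \<times> 'a"
    assume "proportional u v" "proportional v w"
    then obtain x y z c d where u: "u = (x, y, z)" "u \<noteq> (0, 0, 0)" "w \<noteq> (0, 0, 0)"
      and c: "c \<noteq> 0" "d \<noteq> 0" "w = (d * (c * x), d * (c * y), d * (c * z))"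
      by (cases u; cases v; cases w) (auto simp: proportional_def)
    then show "proportional u w"
      by (auto simp: proportional_def intro!: exI[of _ "d * c"])
  qed
qed

quotient_type (overloaded) 'a proportion = "'a::field \<times> 'a \<times> 'a" / partial: proportional
  by (rule part_equivp_proportional)

type_synonym 'a point = "'a proportion"
type_synonym 'a line = "'a proportion"

lift_definition lies_on :: "'a::field point \<Rightarrow> 'a line \<Rightarrow> bool" (infix \<open>lies'_on\<close> 50)
  is "\<lambda>(x, y, z) (l, m, n). l * x + m * y - n * z = 0"
proof -
  fix p q L M :: "'a \<times> 'a \<times> 'a"
  assume "proportional p q" "proportional L M"
  then obtain x y z l m n c d where e: "p = (x, y, z)" "L = (l, m, n)" "c \<noteq> 0" "d \<noteq> 0"
    "q = (c * x, c * y, c * z)" "M = (d * l, d * m, d * n)"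
    by (cases p; cases q; cases L; cases M) (auto simp: proportional_def)
  have "(d * l) * (c * x) + (d * m) * (c * y) - (d * n) * (c * z)
      = (c * d) * (l * x + m * y - n * z)"
    by (simp add: algebra_simps)
  moreover have "c * d \<noteq> 0" using e by simp
  ultimately show "(case p of (x, y, z) \<Rightarrow> \<lambda>(l, m, n). l * x + m * y - n * z = 0) L =
       (case q of (x, y, z) \<Rightarrow> \<lambda>(l, m, n). l * x + m * y - n * z = 0) M"
    unfolding e prod.case by (simp only: mult_eq_0_iff simp_thms)
qed

text \<open>The same formula defines null points and null lines.\<close>

lift_definition null :: "'a::field proportion \<Rightarrow> bool"
  is "\<lambda>(x, y, z). x\<^sup>2 + y\<^sup>2 - z\<^sup>2 = 0"
proof -
  fix p q :: "'a \<times> 'a \<times> 'a"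
  assume "proportional p q"
  then obtain x y z c where e: "p = (x, y, z)" "c \<noteq> 0" "q = (c * x, c * y, c * z)"
    by (cases p; cases q) (auto simp: proportional_def)
  have "(c * x)\<^sup>2 + (c * y)\<^sup>2 - (c * z)\<^sup>2 = c\<^sup>2 * (x\<^sup>2 + y\<^sup>2 - z\<^sup>2)"
    by (simp add: algebra_simps)
  moreover have "c\<^sup>2 \<noteq> 0" using e by simp
  ultimately show "(case p of (x, y, z) \<Rightarrow> x\<^sup>2 + y\<^sup>2 - z\<^sup>2 = 0) =
       (case q of (x, y, z) \<Rightarrow> x\<^sup>2 + y\<^sup>2 - z\<^sup>2 = 0)"
    unfolding e prod.case by (simp only: mult_eq_0_iff simp_thms)
qed

text \<open>The spread is meaningful only if both lines are non-null; otherwise division by zero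
  gives it the junk value 1.\<close>

lift_definition spread :: "'a::field line \<Rightarrow> 'a line \<Rightarrow> 'a"
  is "\<lambda>(l\<^sub>1, m\<^sub>1, n\<^sub>1) (l\<^sub>2, m\<^sub>2, n\<^sub>2).
    1 - (l\<^sub>1 * l\<^sub>2 + m\<^sub>1 * m\<^sub>2 - n\<^sub>1 * n\<^sub>2)\<^sup>2 /
        ((l\<^sub>1\<^sup>2 + m\<^sub>1\<^sup>2 - n\<^sub>1\<^sup>2) * (l\<^sub>2\<^sup>2 + m\<^sub>2\<^sup>2 - n\<^sub>2\<^sup>2))"
proof -
  fix p q L M :: "'a \<times> 'a \<times> 'a"
  assume "proportional p q" "proportional L M"
  then obtain x y z l m n c d where e: "p = (x, y, z)" "L = (l, m, n)" "c \<noteq> 0" "d \<noteq> 0"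
    "q = (c * x, c * y, c * z)" "M = (d * l, d * m, d * n)"
    by (cases p; cases q; cases L; cases M) (auto simp: proportional_def)
  have 1: "((c * x) * (d * l) + (c * y) * (d * m) - (c * z) * (d * n))\<^sup>2
      = (c\<^sup>2 * d\<^sup>2) * (x * l + y * m - z * n)\<^sup>2"
    by (simp add: algebra_simps power2_eq_square)
  have 2: "((c * x)\<^sup>2 + (c * y)\<^sup>2 - (c * z)\<^sup>2) * ((d * l)\<^sup>2 + (d * m)\<^sup>2 - (d * n)\<^sup>2)
      = (c\<^sup>2 * d\<^sup>2) * ((x\<^sup>2 + y\<^sup>2 - z\<^sup>2) * (l\<^sup>2 + m\<^sup>2 - n\<^sup>2))"
    by (simp add: algebra_simps)
  have 3: "c\<^sup>2 * d\<^sup>2 \<noteq> 0" using e by simp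
  show "(case p of (l\<^sub>1, m\<^sub>1, n\<^sub>1) \<Rightarrow> \<lambda>(l\<^sub>2, m\<^sub>2, n\<^sub>2).
      1 - (l\<^sub>1 * l\<^sub>2 + m\<^sub>1 * m\<^sub>2 - n\<^sub>1 * n\<^sub>2)\<^sup>2 /
        ((l\<^sub>1\<^sup>2 + m\<^sub>1\<^sup>2 - n\<^sub>1\<^sup>2) * (l\<^sub>2\<^sup>2 + m\<^sub>2\<^sup>2 - n\<^sub>2\<^sup>2))) L =
    (case q of (l\<^sub>1, m\<^sub>1, n\<^sub>1) \<Rightarrow> \<lambda>(l\<^sub>2, m\<^sub>2, n\<^sub>2).
      1 - (l\<^sub>1 * l\<^sub>2 + m\<^sub>1 * m\<^sub>2 - n\<^sub>1 * n\<^sub>2)\<^sup>2 /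
        ((l\<^sub>1\<^sup>2 + m\<^sub>1\<^sup>2 - n\<^sub>1\<^sup>2) * (l\<^sub>2\<^sup>2 + m\<^sub>2\<^sup>2 - n\<^sub>2\<^sup>2))) M"
    unfolding e prod.case 1 2 mult_divide_mult_cancel_left[OF 3] ..
qed

definition join :: "'a::field point \<Rightarrow> 'a point \<Rightarrow> 'a line" where
  "join a b = (THE L. a lies_on L \<and> b lies_on L)"

definition meet :: "'a::field line \<Rightarrow> 'a line \<Rightarrow> 'a point" where
  "meet L M = (THE a. a lies_on L \<and> a lies_on M)"

definition concurrent :: "'a::field line \<Rightarrow> 'a line \<Rightarrow> 'a line \<Rightarrow> bool" where
  "concurrent L M N \<longleftrightarrow> (\<exists>a. a lies_on L \<and> a lies_on M \<and> a lies_on N)"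

text \<open>The descriptions in \<^const>\<open>join\<close> and \<^const>\<open>meet\<close> are well-posed for distinct arguments.\<close>

lemma lies_on_commute: "a lies_on L \<longleftrightarrow> L lies_on a"
  by transfer (auto simp: mult.commute)

lemma orthogonal_imp_proportional:
  fixes x y z :: "'a::field"
  assumes "(x, y, z) \<noteq> (0, 0, 0)"
    and "(b * r - c * q, c * p - a * r, a * q - b * p) \<noteq> (0, 0, 0)"
    and 1: "a * x + b * y + c * z = 0" and 2: "p * x + q * y + r * z = 0"
  shows "\<exists>k. k \<noteq> 0 \<and> x = k * (b * r - c * q) \<and> y = k * (c * p - a * r) \<and> z = k * (a * q - b * p)"
proof -
  define u v w where "u = b * r - c * q" "v = c * p - a * r" "w = a * q - b * p"
  have a: "u * y = v * x" and b: "v * z = w * y" and c: "w * x = u * z"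
    unfolding u_v_w_def using 1 2 by algebra+
  have "u \<noteq> 0 \<or> v \<noteq> 0 \<or> w \<noteq> 0" using assms(2) by (auto simp: u_v_w_def)
  then obtain k where "x = k * u \<and> y = k * v \<and> z = k * w"
  proof (elim disjE)
    assume "u \<noteq> 0" then show ?thesis using a c
      by (intro that[of "x / u"]) (auto simp: field_simps)
  next
    assume "v \<noteq> 0" then show ?thesis using a b
      by (intro that[of "y / v"]) (auto simp: field_simps)
  next
    assume "w \<noteq> 0" then show ?thesis using b c
      by (intro that[of "z / w"]) (auto simp: field_simps)
  qed
  moreover from this assms(1) have "k \<noteq> 0" by auto
  ultimately show ?thesis unfolding u_v_w_def by blast
qed

lemma proportional_refl_iff [simp]: "proportional u u \<longleftrightarrow> u \<noteq> (0, 0, 0)"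
  by (cases u) (auto simp: proportional_def intro!: exI[of _ 1])

lemma proportion_cases:
  fixes P :: "'a::field proportion"
  obtains x y z where "(x, y, z) \<noteq> (0, 0, 0)" "P = abs_proportion (x, y, z)"
proof -
  obtain x y z where r: "rep_proportion P = (x, y, z)" by (cases "rep_proportion P")
  have "proportional (rep_proportion P) (rep_proportion P)"
    using Quotient_proportion by (rule Quotient_rep_reflp)
  moreover have "abs_proportion (rep_proportion P) = P"
    using Quotient_proportion by (rule Quotient_abs_rep)
  ultimately show ?thesis
    using that[of x y z] r by (simp only: proportional_refl_iff) simp
qed

lemma abs_proportion_eq_iff:
  assumes "(x, y, z) \<noteq> (0, 0, 0)" "(x', y', z') \<noteq> (0, 0, 0)"
  shows "abs_proportion (x, y, z) = abs_proportion (x', y', z') \<longleftrightarrow>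
    (\<exists>c. c \<noteq> 0 \<and> x' = c * x \<and> y' = c * y \<and> z' = c * z)"
proof -
  have "abs_proportion (x, y, z) = abs_proportion (x', y', z') \<longleftrightarrow>
      proportional (x, y, z) (x', y', z')"
    using Quotient_rel[OF Quotient_proportion, of "(x, y, z)" "(x', y', z')"] assms
    by (simp only: proportional_refl_iff) blast
  then show ?thesis using assms by (simp add: proportional_def)
qed

lemma abs_lies_on_abs_iff:
  assumes "(x, y, z) \<noteq> (0, 0, 0)" "(l, m, n) \<noteq> (0, 0, 0)"
  shows "abs_proportion (x, y, z) lies_on abs_proportion (l, m, n) \<longleftrightarrow>
    l * x + m * y - n * z = 0"
  using assms by (subst lies_on.abs_eq) (simp_all only: proportional_refl_iff prod.case not_False_eq_True)

lemma ex1_meet: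
  fixes L M :: "'a::field line"
  assumes "L \<noteq> M"
  shows "\<exists>!a. a lies_on L \<and> a lies_on M"
proof -
  obtain l m n where L: "(l, m, n) \<noteq> (0, 0, 0)" "L = abs_proportion (l, m, n)"
    by (rule proportion_cases)
  obtain p q r where M: "(p, q, r) \<noteq> (0, 0, 0)" "M = abs_proportion (p, q, r)"
    by (rule proportion_cases)
  define u v w where uvw: "u = n * q - m * r" "v = l * r - n * p" "w = l * q - m * p"
  have nz: "(u, v, w) \<noteq> (0, 0, 0)"
  proof
    assume "(u, v, w) = (0, 0, 0)"
    then have e: "n * q = m * r" "l * r = n * p" "l * q = m * p" by (simp_all add: uvw)
    obtain c where c: "p = c * l \<and> q = c * m \<and> r = c * n"
    proof -
      consider "l \<noteq> 0" | "m \<noteq> 0" | "n \<noteq> 0" using L(1) by auto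
      then show ?thesis
      proof cases
        case 1 then show ?thesis using e
          by (intro that[of "p / l"]) (simp add: nonzero_eq_divide_eq mult.commute)
      next
        case 2 then show ?thesis using e
          by (intro that[of "q / m"]) (simp add: nonzero_eq_divide_eq mult.commute)
      next
        case 3 then show ?thesis using e
          by (intro that[of "r / n"]) (simp add: nonzero_eq_divide_eq mult.commute)
      qed
    qed
    then have "c \<noteq> 0" using M(1) by auto
    with c have "L = M" unfolding L(2) M(2) abs_proportion_eq_iff[OF L(1) M(1)] by blast
    with assms show False by contradiction
  qed
  show ?thesis
  proof (rule ex1I[of _ "abs_proportion (u, v, w)"])
    show "abs_proportion (u, v, w) lies_on L \<and> abs_proportion (u, v, w) lies_on M"
      unfolding L(2) M(2) abs_lies_on_abs_iff[OF nz L(1)] abs_lies_on_abs_iff[OF nz M(1)]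
      unfolding uvw
      by (simp add: algebra_simps)
  next
    fix a assume a: "a lies_on L \<and> a lies_on M"
    obtain x y z where xyz: "(x, y, z) \<noteq> (0, 0, 0)" "a = abs_proportion (x, y, z)"
      by (rule proportion_cases)
    have "l * x + m * y - n * z = 0" "p * x + q * y - r * z = 0"
      using a unfolding xyz(2) L(2) M(2) abs_lies_on_abs_iff[OF xyz(1) L(1)]
        abs_lies_on_abs_iff[OF xyz(1) M(1)] by auto
    then have "\<exists>k. k \<noteq> 0 \<and> x = k * (m * (- r) - (- n) * q) \<and> y = k * ((- n) * p - l * (- r))
        \<and> z = k * (l * q - m * p)"
      using nz xyz(1) by (intro orthogonal_imp_proportional) (simp_all add: uvw)
    then have "\<exists>k. k \<noteq> 0 \<and> x = k * u \<and> y = k * v \<and> z = k * w"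
      by (simp add: uvw algebra_simps)
    then show "a = abs_proportion (u, v, w)"
      using abs_proportion_eq_iff[OF nz xyz(1)] xyz(2) by metis
  qed
qed

lemma ex1_join:
  fixes a b :: "'a::field point"
  assumes "a \<noteq> b"
  shows "\<exists>!L. a lies_on L \<and> b lies_on L"
  using ex1_meet[OF assms] by (simp only: lies_on_commute[of a] lies_on_commute[of b])

end

theory Submission
  imports Defs
begin

text \<open>Write \<open>t\<^sub>i\<close> for the value at \<open>a\<close> of the linear form of \<open>A\<^sub>i\<close>. The join of \<open>a\<close> with
  \<open>A\<^sub>2A\<^sub>3\<close> is \<open>D\<^sub>1 = t\<^sub>3A\<^sub>2 - t\<^sub>2A\<^sub>3\<close>. A spread is the Gram determinant of the two lines divided by
  the product of their quadratic forms, and the Gram determinants of \<open>(A\<^sub>2, D\<^sub>1)\<close> and \<open>(D\<^sub>1, A\<^sub>3)\<close> are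
  \<open>t\<^sub>2\<^sup>2\<close> and \<open>t\<^sub>3\<^sup>2\<close> times that of \<open>(A\<^sub>2, A\<^sub>3)\<close>. So \<open>R\<^sub>1 : T\<^sub>1\<close> is the ratio of \<open>t\<^sub>i\<^sup>2\<close> over the
  quadratic form of \<open>A\<^sub>i\<close> for \<open>i = 2, 3\<close>, and these ratios multiply cyclically to 1.\<close>

lemma meet_commute: "meet L M = meet M L"
  unfolding meet_def by (simp only: conj_commute)

lemma
  fixes L M :: "'a::field line"
  assumes "L \<noteq> M"
  shows meet_lies_on_left: "meet L M lies_on L"
    and meet_lies_on_right: "meet L M lies_on M"
  using theI'[OF ex1_meet[OF assms]] by (simp_all add: meet_def)

lemma meet_eqI:
  assumes "L \<noteq> M" "a lies_on L" "a lies_on M"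
  shows "meet L M = a"
  unfolding meet_def using assms by (intro the1_equality ex1_meet) auto

lemma join_eqI:
  assumes "a \<noteq> b" "a lies_on L" "b lies_on L"
  shows "join a b = L"
  unfolding join_def using assms by (intro the1_equality ex1_join) auto

lemma ex_common_point:
  fixes L M :: "'a::field line"
  shows "\<exists>a. a lies_on L \<and> a lies_on M"
proof (cases "L = M")
  case False
  then show ?thesis using ex1_meet by blast
next
  case True
  \<comment> \<open>When \<open>L = M\<close>, any second line \<open>N\<close> yields a point by
    meeting \<open>L\<close>. Two distinct proportions exist, so at least one of them differs from
    \<open>L\<close>.\<close>
  have "abs_proportion (1, 0, 0) \<noteq> abs_proportion (0, 1, 0 :: 'a)"
    by (subst abs_proportion_eq_iff) auto
  then obtain N where "L \<noteq> N" by metis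
  then show ?thesis using True ex1_meet by blast
qed

text \<open>If two of the three lines coincided, a common point of that line and the remaining one
  would lie on all three.\<close>

lemma not_concurrent_imp_distinct:
  assumes "\<not> concurrent L M N"
  shows "L \<noteq> M" "M \<noteq> N" "L \<noteq> N"
  using assms ex_common_point unfolding concurrent_def by blast+

lemma null_abs_iff:
  assumes "(x, y, z) \<noteq> (0, 0, 0)"
  shows "null (abs_proportion (x, y, z)) \<longleftrightarrow> x\<^sup>2 + y\<^sup>2 - z\<^sup>2 = 0"
  using assms by (subst null.abs_eq) (simp_all only: proportional_refl_iff prod.case not_False_eq_True)

lemma spread_abs:
  assumes "(l, m, n) \<noteq> (0, 0, 0)" "(p, q, r) \<noteq> (0, 0, 0)"
  shows "spread (abs_proportion (l, m, n)) (abs_proportion (p, q, r)) =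
    1 - (l * p + m * q - n * r)\<^sup>2 / ((l\<^sup>2 + m\<^sup>2 - n\<^sup>2) * (p\<^sup>2 + q\<^sup>2 - r\<^sup>2))"
  using assms by (subst spread.abs_eq) (simp_all only: proportional_refl_iff prod.case not_False_eq_True)

text \<open>Every combination of the two linear forms vanishes at the meet, and the coefficients
  \<open>t\<close> and \<open>- s\<close> make it vanish at \<open>a\<close> as well. As
  \<open>L\<close> and \<open>M\<close> are independent and \<open>a\<close> is not on both, the
  combination is nonzero.\<close>

lemma join_meet_eq:
  fixes l m n p q r x y z :: "'a::field"
  defines "L \<equiv> abs_proportion (l, m, n)" and "M \<equiv> abs_proportion (p, q, r)"
    and "a \<equiv> abs_proportion (x, y, z)"
    and "s \<equiv> l * x + m * y - n * z" and "t \<equiv> p * x + q * y - r * z"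
  assumes L: "(l, m, n) \<noteq> (0, 0, 0)" and M: "(p, q, r) \<noteq> (0, 0, 0)"
    and a: "(x, y, z) \<noteq> (0, 0, 0)"
    and "L \<noteq> M" "a \<noteq> meet L M"
  shows "(t * l - s * p, t * m - s * q, t * n - s * r) \<noteq> (0, 0, 0)" (is "?D \<noteq> _")
    and "join a (meet L M) = abs_proportion (t * l - s * p, t * m - s * q, t * n - s * r)"
proof -
  have aL: "a lies_on L \<longleftrightarrow> s = 0" and aM: "a lies_on M \<longleftrightarrow> t = 0"
    unfolding L_def M_def a_def s_def t_def
    using abs_lies_on_abs_iff[OF a L] abs_lies_on_abs_iff[OF a M] by simp_all
  show D: "?D \<noteq> (0, 0, 0)"
  proof
    assume "?D = (0, 0, 0)"
    then have e: "t * l = s * p" "t * m = s * q" "t * n = s * r" by simp_all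
    have "s \<noteq> 0 \<or> t \<noteq> 0"
      using meet_eqI[OF \<open>L \<noteq> M\<close>] \<open>a \<noteq> meet L M\<close> aL aM by blast
    \<comment> \<open>If one of \<open>s\<close>, \<open>t\<close> were zero, \<open>e\<close> would
      force the other to be zero too, since neither line has the zero triple.\<close>
    with e L M have "s \<noteq> 0" "t \<noteq> 0" by auto
    with e have "t / s \<noteq> 0" "p = t / s * l" "q = t / s * m" "r = t / s * n"
      by (simp_all add: field_simps)
    then have "L = M"
      unfolding L_def M_def abs_proportion_eq_iff[OF L M] by blast
    with \<open>L \<noteq> M\<close> show False by contradiction
  qed
  show "join a (meet L M) = abs_proportion ?D"
  proof (rule join_eqI[OF \<open>a \<noteq> meet L M\<close>])
    show "a lies_on abs_proportion ?D"
      unfolding a_def abs_lies_on_abs_iff[OF a D] by (simp add: s_def t_def algebra_simps)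
    obtain u v w where b: "(u, v, w) \<noteq> (0, 0, 0)" "meet L M = abs_proportion (u, v, w)"
      by (rule proportion_cases)
    have 1: "l * u + m * v - n * w = 0" and 2: "p * u + q * v - r * w = 0"
      using meet_lies_on_left[OF \<open>L \<noteq> M\<close>] meet_lies_on_right[OF \<open>L \<noteq> M\<close>]
      unfolding b(2) unfolding L_def M_def abs_lies_on_abs_iff[OF b(1) L] abs_lies_on_abs_iff[OF b(1) M]
      by auto
    have "(t * l - s * p) * u + (t * m - s * q) * v - (t * n - s * r) * w
        = t * (l * u + m * v - n * w) - s * (p * u + q * v - r * w)"
      by (simp add: algebra_simps)
    then show "meet L M lies_on abs_proportion ?D"
      unfolding b(2) abs_lies_on_abs_iff[OF b(1) D] by (simp add: 1 2)
  qed
qed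

text \<open>Isolates the factor \<open>c\<close> that the two spreads share. What remains in each
  spread depends, for fixed \<open>a\<close>, on one line only, which makes cancellation around the
  triangle possible.\<close>

lemma spread_join_meet:
  fixes l m n p q r x y z :: "'a::field"
  defines "L \<equiv> abs_proportion (l, m, n)" and "M \<equiv> abs_proportion (p, q, r)"
    and "a \<equiv> abs_proportion (x, y, z)"
  assumes L: "(l, m, n) \<noteq> (0, 0, 0)" and M: "(p, q, r) \<noteq> (0, 0, 0)"
    and a: "(x, y, z) \<noteq> (0, 0, 0)"
    and "\<not> null L" "\<not> null M" "L \<noteq> M" "a \<noteq> meet L M" "\<not> null (join a (meet L M))"
  obtains c where
    "spread L (join a (meet L M)) = c * ((l * x + m * y - n * z)\<^sup>2 / (l\<^sup>2 + m\<^sup>2 - n\<^sup>2))"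
    "spread (join a (meet L M)) M = c * ((p * x + q * y - r * z)\<^sup>2 / (p\<^sup>2 + q\<^sup>2 - r\<^sup>2))"
proof -
  define s t where "s = l * x + m * y - n * z" and "t = p * x + q * y - r * z"
  define d e f where "d = t * l - s * p" and "e = t * m - s * q" and "f = t * n - s * r"
  have D: "(d, e, f) \<noteq> (0, 0, 0)" "join a (meet L M) = abs_proportion (d, e, f)"
    unfolding d_def e_def f_def s_def t_def L_def M_def a_def
    using assms by (intro join_meet_eq; simp)+
  define QL QM QD where "QL = l\<^sup>2 + m\<^sup>2 - n\<^sup>2" and "QM = p\<^sup>2 + q\<^sup>2 - r\<^sup>2" and "QD = d\<^sup>2 + e\<^sup>2 - f\<^sup>2"
  have nz: "QL \<noteq> 0" "QM \<noteq> 0" "QD \<noteq> 0"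
    using assms(7,8,11) unfolding D(2) unfolding L_def M_def null_abs_iff[OF L] null_abs_iff[OF M]
      null_abs_iff[OF D(1)] QL_def QM_def QD_def by auto
  \<comment> \<open>The Gram determinant of \<open>L\<close> and \<open>M\<close>.\<close>
  define G where "G = QL * QM - (l * p + m * q - n * r)\<^sup>2"
  \<comment> \<open>The second vector is \<open>t * L - s * M\<close>. Removing the multiple of
    \<open>L\<close> leaves the Gram determinant unchanged, and the factor \<open>- s\<close>
    contributes its square. In the next identity the multiple of \<open>M\<close> is removed
    instead.\<close>
  have 1: "QL * QD - (l * d + m * e - n * f)\<^sup>2 = G * s\<^sup>2"
    unfolding G_def QL_def QM_def QD_def d_def e_def f_def
    by (simp add: power2_eq_square algebra_simps)
  have 2: "QD * QM - (d * p + e * q - f * r)\<^sup>2 = G * t\<^sup>2"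
    unfolding G_def QL_def QM_def QD_def d_def e_def f_def
    by (simp add: power2_eq_square algebra_simps)
  show ?thesis
  proof (rule that[of "G / QD"])
    \<comment> \<open>Non-null lines have a nonzero denominator, so 1 can be absorbed into the
      fraction.\<close>
    have "spread L (join a (meet L M)) = (QL * QD - (l * d + m * e - n * f)\<^sup>2) / (QL * QD)"
      unfolding D(2) unfolding L_def spread_abs[OF L D(1)] QL_def[symmetric] QD_def[symmetric]
      using nz by (simp add: diff_divide_distrib)
    then show "spread L (join a (meet L M)) =
        G / QD * ((l * x + m * y - n * z)\<^sup>2 / (l\<^sup>2 + m\<^sup>2 - n\<^sup>2))"
      unfolding 1 by (simp add: QL_def s_def mult.commute)
    have "spread (join a (meet L M)) M = (QD * QM - (d * p + e * q - f * r)\<^sup>2) / (QD * QM)"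
      unfolding D(2) unfolding M_def spread_abs[OF D(1) M] QM_def[symmetric] QD_def[symmetric]
      using nz by (simp add: diff_divide_distrib)
    then show "spread (join a (meet L M)) M =
        G / QD * ((p * x + q * y - r * z)\<^sup>2 / (p\<^sup>2 + q\<^sup>2 - r\<^sup>2))"
      unfolding 2 by (simp add: QM_def t_def)
  qed
qed

theorem theorem77:
  fixes A\<^sub>1 A\<^sub>2 A\<^sub>3 :: "'a::field line" and a :: "'a point"
    and D\<^sub>1 D\<^sub>2 D\<^sub>3 :: "'a line" and R\<^sub>1 R\<^sub>2 R\<^sub>3 T\<^sub>1 T\<^sub>2 T\<^sub>3 :: 'a
  assumes "CHAR('a) \<noteq> 2"
    and "\<not> null A\<^sub>1" and "\<not> null A\<^sub>2" and "\<not> null A\<^sub>3"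
    and "\<not> concurrent A\<^sub>1 A\<^sub>2 A\<^sub>3"
    and "\<not> null (meet A\<^sub>1 A\<^sub>2)" and "\<not> null (meet A\<^sub>2 A\<^sub>3)" and "\<not> null (meet A\<^sub>1 A\<^sub>3)"
    and "\<not> null a"
    and "a \<noteq> meet A\<^sub>1 A\<^sub>2" and "a \<noteq> meet A\<^sub>2 A\<^sub>3" and "a \<noteq> meet A\<^sub>1 A\<^sub>3"
    and "D\<^sub>1 = join a (meet A\<^sub>2 A\<^sub>3)"
    and "D\<^sub>2 = join a (meet A\<^sub>1 A\<^sub>3)"
    and "D\<^sub>3 = join a (meet A\<^sub>1 A\<^sub>2)"
    and "\<not> null D\<^sub>1" and "\<not> null D\<^sub>2" and "\<not> null D\<^sub>3"
    and "R\<^sub>1 = spread A\<^sub>2 D\<^sub>1" and "T\<^sub>1 = spread D\<^sub>1 A\<^sub>3"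
    and "R\<^sub>2 = spread A\<^sub>3 D\<^sub>2" and "T\<^sub>2 = spread D\<^sub>2 A\<^sub>1"
    and "R\<^sub>3 = spread A\<^sub>1 D\<^sub>3" and "T\<^sub>3 = spread D\<^sub>3 A\<^sub>2"
  shows "R\<^sub>1 * R\<^sub>2 * R\<^sub>3 = T\<^sub>1 * T\<^sub>2 * T\<^sub>3"
proof -
  obtain l\<^sub>1 m\<^sub>1 n\<^sub>1 where A1: "(l\<^sub>1, m\<^sub>1, n\<^sub>1) \<noteq> (0, 0, 0)" "A\<^sub>1 = abs_proportion (l\<^sub>1, m\<^sub>1, n\<^sub>1)"
    by (rule proportion_cases)
  obtain l\<^sub>2 m\<^sub>2 n\<^sub>2 where A2: "(l\<^sub>2, m\<^sub>2, n\<^sub>2) \<noteq> (0, 0, 0)" "A\<^sub>2 = abs_proportion (l\<^sub>2, m\<^sub>2, n\<^sub>2)"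
    by (rule proportion_cases)
  obtain l\<^sub>3 m\<^sub>3 n\<^sub>3 where A3: "(l\<^sub>3, m\<^sub>3, n\<^sub>3) \<noteq> (0, 0, 0)" "A\<^sub>3 = abs_proportion (l\<^sub>3, m\<^sub>3, n\<^sub>3)"
    by (rule proportion_cases)
  obtain x y z where a: "(x, y, z) \<noteq> (0, 0, 0)" "a = abs_proportion (x, y, z)"
    by (rule proportion_cases)
  \<comment> \<open>The weight of a line relative to \<open>a\<close>. It does not change when the
    line's triple is rescaled, and one fixed triple for \<open>a\<close> serves all three
    lines.\<close>
  define w where "w l m n = (l * x + m * y - n * z)\<^sup>2 / (l\<^sup>2 + m\<^sup>2 - n\<^sup>2)" for l m n
  note ne = not_concurrent_imp_distinct[OF \<open>\<not> concurrent A\<^sub>1 A\<^sub>2 A\<^sub>3\<close>]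
  obtain c\<^sub>1 where "R\<^sub>1 = c\<^sub>1 * w l\<^sub>2 m\<^sub>2 n\<^sub>2" "T\<^sub>1 = c\<^sub>1 * w l\<^sub>3 m\<^sub>3 n\<^sub>3"
    using spread_join_meet[OF A2(1) A3(1) a(1), folded A2(2) A3(2) a(2) w_def] assms ne by blast
  moreover obtain c\<^sub>2 where "R\<^sub>2 = c\<^sub>2 * w l\<^sub>3 m\<^sub>3 n\<^sub>3" "T\<^sub>2 = c\<^sub>2 * w l\<^sub>1 m\<^sub>1 n\<^sub>1"
    \<comment> \<open>The cyclic order \<open>A\<^sub>3\<close>, \<open>A\<^sub>1\<close> matches
      \<open>R\<^sub>2\<close> and \<open>T\<^sub>2\<close>, while \<open>D\<^sub>2\<close> uses the
      meet in the opposite order.\<close>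
    using spread_join_meet[OF A3(1) A1(1) a(1),
        folded A3(2) A1(2) a(2) w_def, unfolded meet_commute[of A\<^sub>3 A\<^sub>1]] assms ne by blast
  moreover obtain c\<^sub>3 where "R\<^sub>3 = c\<^sub>3 * w l\<^sub>1 m\<^sub>1 n\<^sub>1" "T\<^sub>3 = c\<^sub>3 * w l\<^sub>2 m\<^sub>2 n\<^sub>2"
    using spread_join_meet[OF A1(1) A2(1) a(1), folded A1(2) A2(2) a(2) w_def] assms ne by blast
  \<comment> \<open>Both products consist of the three constants and each of the three weights
    once.\<close>
  ultimately show ?thesis by simp
qed

end
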